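(* Let $r^1,\ldots,r^n\in\mathbb{Z}^n$ satisfy $1\leq |\det(r^1,\ldots,r^n)|\leq 5$. Then $$\operatorname{ICR}(\operatorname{pos}\{r^1,\ldots,r^n\})=n.$$
   Context: $\operatorname{pos}X$ denotes the set of all finite non-negative real linear combinations of elements of $X\subseteq\mathbb{R}^n$. $\mathbb{N}$ denotes the non-negative integers. For a pointed rational cone $C\subseteq\mathbb{R}^n$, the Hilbert basis $\mathcal{H}(C)$ is the unique minimal set of vectors in $C\cap\mathbb{Z}^n$ such that every element of $C\cap\mathbb{Z}^n$ is a non-negative integral combination of elements of the set (it is finite). The integer Carathéodory rank of $C$ is $$\operatorname{ICR}(C):=\max_{z\in C\cap\mathbb{Z}^n}\min\Big\{k : z=\sum_{i=1}^k\lambda_i h^i\text{ with }\lambda_i\in\mathbb{N},\ h^i\in\mathcal{H}(C)\text{ for all }i\in\{1,\ldots,k\}\Big\},$$ i.e. the smallest $k$ such that every integer vector in $C$ is a non-negative integral combination of at most $k$ Hilbert basis elements. *)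

theory Defs
  imports "HOL-Analysis.Analysis"
begin

definition int_vectors :: "(real ^ 'n) set" where
  "int_vectors = {x. \<forall>i. x $ i \<in> \<int>}"

definition pos :: "'a::real_vector set \<Rightarrow> 'a set" where
  "pos X = {\<Sum>x\<in>S. c x *\<^sub>R x | S c. finite S \<and> S \<subseteq> X \<and> (\<forall>x\<in>S. 0 \<le> c x)}"

definition nonneg_int_combinations :: "'a::real_vector set \<Rightarrow> 'a set" where
  "nonneg_int_combinations X =
    {\<Sum>x\<in>S. real (c x) *\<^sub>R x | S c. finite S \<and> S \<subseteq> X}"

definition int_generating :: "(real ^ 'n) set \<Rightarrow> (real ^ 'n) set \<Rightarrow> bool" where
  "int_generating C H \<longleftrightarrow>
    H \<subseteq> C \<inter> int_vectors \<and> C \<inter> int_vectors \<subseteq> nonneg_int_combinations H"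

(* Minimality is with respect to inclusion. The description is proper when there is exactly
   one minimal generating set, in particular for every pointed rational cone C. *)
definition hilbert_basis :: "(real ^ 'n) set \<Rightarrow> (real ^ 'n) set" where
  "hilbert_basis C =
    (THE H. int_generating C H \<and> (\<forall>H'. int_generating C H' \<and> H' \<subseteq> H \<longrightarrow> H' = H))"

definition rep_length :: "(real ^ 'n) set \<Rightarrow> real ^ 'n \<Rightarrow> nat" where
  "rep_length C z = (LEAST k. \<exists>(l :: nat \<Rightarrow> nat) (h :: nat \<Rightarrow> real ^ 'n).
     (\<forall>i\<in>{1..k}. h i \<in> hilbert_basis C) \<and> z = (\<Sum>i=1..k. real (l i) *\<^sub>R h i))"

(* Max is unspecified on infinite sets, so an equation ICR C = k can only be derived
   together with the boundedness of rep_length C on the integer vectors of C. *)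
definition ICR :: "(real ^ 'n) set \<Rightarrow> nat" where
  "ICR C = Max (rep_length C ` (C \<inter> int_vectors))"

end

theory Submission
  imports Defs "HOL-Library.Multiset"
begin

text \<open>
Write an integer vector of the cone in the basis \<open>r\<close> and multiply its coordinates by \<open>d\<close>, the absolute
value of the determinant. By Cramer's rule this turns the integer points of the cone into the
nonnegative vectors \<open>u\<close> of a lattice \<open>L \<subseteq> \<int>\<^sup>n\<close> that contains all \<open>d e\<^sub>i\<close>. Modulo the \<open>d e\<^sub>i\<close> every element of
\<open>L\<close> is congruent to a residue vector, whose entries lie in \<open>{0..d-1}\<close>. The residue vectors form a
group of order \<open>d\<close>.

Upper bound. A packing of \<open>u\<close> is a multiset \<open>K\<close> of nonzero residue vectors with sum at most \<open>u\<close> and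
congruent to \<open>u\<close> modulo \<open>d\<close>; then \<open>u\<close> is the sum of \<open>K\<close> and of multiples of the \<open>d e\<^sub>i\<close> at the coordinates
\<open>i\<close> that are not tight, i.e. where the sum of \<open>K\<close> has not reached \<open>u\<close>. Let \<open>K\<close> have as many members as
possible. A coordinate that is not tight has slack at least \<open>d\<close>, so only tight coordinates can prevent
that a member \<open>c\<close> is replaced by two vectors \<open>p\<close>, \<open>q\<close> with \<open>p + q\<close> congruent to \<open>c\<close>
(\<open>longest_split\<close>, \<open>longest_opposite\<close>). Consequently all vectors in use are irreducible, and a nonzero
residue vector does not vanish on the tight coordinates. The decomposition uses at most \<open>n\<close> different
irreducible vectors as soon as \<open>K\<close> has at most as many different members as there are tight
coordinates (\<open>short_if_card_le\<close>).

For \<open>2 \<le> d \<le> 5\<close> this inequality is established by looking at the tight coordinates. If some residue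
vector has entry 1 at a tight coordinate, the group is cyclic and consists of its multiples
\<open>x\<^sub>0, x\<^sub>1, \<dots>, x\<^sub>d\<^sub>-\<^sub>1\<close>; otherwise \<open>d = 4\<close> and all entries at tight coordinates are 0 or 2. Most cases are
settled because few of the residue vectors are irreducible on the tight coordinates. In the
remaining ones, all cyclic, a repeated exchange of \<open>x\<^sub>1 + x\<^sub>4\<close> for \<open>x\<^sub>2 + x\<^sub>3\<close> or of \<open>x\<^sub>1 + x\<^sub>3\<close> for \<open>2 x\<^sub>2\<close>
keeps the packing longest and ends when one of the exchanged members is used up or another
coordinate becomes tight (\<open>exchange\<close>).

Lower bound. The Hilbert basis is finite, so the integer points of the cone that are combinations
of fewer than \<open>n\<close> of its elements lie in finitely many proper subspaces. The moment curve meets each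
of these in finitely many points (\<open>moment_point_outside_spans\<close>).
\<close>

section \<open>Packings by residue vectors\<close>

definition irreducibles :: "'a::ab_group_add set \<Rightarrow> 'a set" where
  "irreducibles M = {z \<in> M. z \<noteq> 0 \<and> (\<forall>p\<in>M. \<forall>q\<in>M. z = p + q \<longrightarrow> p = 0 \<or> q = 0)}"

text \<open>
Since \<open>L\<close> is a group and contains the vectors \<open>d e\<^sub>i\<close>, it is a union of residue classes modulo \<open>d\<close>.
\<close>
locale scaled_lattice =
  fixes d :: int and L :: "(int ^ 'n::finite) set"
  assumes d_pos: "0 < d"
    and diff_in: "u \<in> L \<Longrightarrow> v \<in> L \<Longrightarrow> u - v \<in> L"
    and axis_in: "axis i d \<in> L"
begin

lemma zero_in: "0 \<in> L"
  using diff_in[OF axis_in axis_in, of undefined undefined] by simp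

lemma add_in:
  assumes "u \<in> L" "v \<in> L" shows "u + v \<in> L"
  using diff_in[OF assms(1) diff_in[OF zero_in assms(2)]] by simp

lemma scale_in:
  assumes "u \<in> L" shows "k *s u \<in> L"
proof (induction k rule: int_induct[where k = 0])
  case base
  then show ?case using zero_in by simp
next
  case (step1 k)
  have "(k + 1) *s u = k *s u + u"
    by (simp add: vec_eq_iff algebra_simps)
  then show ?case using add_in[OF step1(2) assms] by simp
next
  case (step2 k)
  have "(k - 1) *s u = k *s u - u"
    by (simp add: vec_eq_iff algebra_simps)
  then show ?case using diff_in[OF step2(2) assms] by simp
qed

lemma sum_in: "(\<And>i. i \<in> A \<Longrightarrow> f i \<in> L) \<Longrightarrow> sum f A \<in> L"
  by (induction A rule: infinite_finite_induct) (auto simp: zero_in add_in)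

lemma divisible_in:
  assumes "\<And>i. d dvd u $ i" shows "u \<in> L"
proof -
  have "u = (\<Sum>i\<in>UNIV. (u $ i div d) *s axis i d)"
    using assms by (simp add: vec_eq_iff sum_component axis_def if_distrib sum.delta cong: if_cong)
  moreover have "(\<Sum>i\<in>UNIV. (u $ i div d) *s axis i d) \<in> L"
    by (intro sum_in scale_in axis_in)
  ultimately show ?thesis by simp
qed

definition cell :: "(int ^ 'n) set" where
  "cell = {u \<in> L. \<forall>i. 0 \<le> u $ i \<and> u $ i < d}"

definition reduce :: "int ^ 'n \<Rightarrow> int ^ 'n" where
  "reduce u = (\<chi> i. u $ i mod d)"

lemma reduce_nth [simp]: "reduce u $ i = u $ i mod d"
  by (simp add: reduce_def)

lemma reduce_in_cell:
  assumes "u \<in> L" shows "reduce u \<in> cell"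
proof -
  have "u - reduce u \<in> L"
    by (rule divisible_in) (simp add: minus_mod_eq_mult_div)
  from diff_in[OF assms this] show ?thesis
    using d_pos by (simp add: cell_def)
qed

lemma cell_D: "u \<in> cell \<Longrightarrow> u \<in> L" "u \<in> cell \<Longrightarrow> 0 \<le> u $ i" "u \<in> cell \<Longrightarrow> u $ i < d"
  by (auto simp: cell_def)

lemma cell_eqI:
  assumes "u \<in> cell" "v \<in> cell" "\<And>i. d dvd u $ i - v $ i"
  shows "u = v"
proof -
  have "u $ i = v $ i" for i
    using assms(3)[of i] cell_D(2,3)[OF assms(1), of i] cell_D(2,3)[OF assms(2), of i]
    by (metis mod_eq_dvd_iff mod_pos_pos_trivial)
  then show ?thesis by (simp add: vec_eq_iff)
qed

definition orthant :: "(int ^ 'n) set" where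
  "orthant = {u \<in> L. \<forall>i. 0 \<le> u $ i}"

definition packing :: "int ^ 'n \<Rightarrow> (int ^ 'n) multiset \<Rightarrow> bool" where
  "packing u K \<longleftrightarrow> set_mset K \<subseteq> cell - {0} \<and>
     (\<forall>i. (\<Sum>\<^sub># K) $ i \<le> u $ i \<and> d dvd u $ i - (\<Sum>\<^sub># K) $ i)"

definition tight :: "int ^ 'n \<Rightarrow> (int ^ 'n) multiset \<Rightarrow> 'n set" where
  "tight u K = {i. (\<Sum>\<^sub># K) $ i = u $ i}"

definition longest :: "int ^ 'n \<Rightarrow> (int ^ 'n) multiset \<Rightarrow> bool" where
  "longest u K \<longleftrightarrow> packing u K \<and> (\<forall>K'. packing u K' \<longrightarrow> size K' \<le> size K)"

text \<open>
Nonzero residue vectors have positive entry sum. This bounds the size of all packings of a fixed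
vector, so a longest one exists.
\<close>
lemma size_le_sum:
  assumes "set_mset K \<subseteq> cell - {0}"
  shows "int (size K) \<le> (\<Sum>i\<in>UNIV. (\<Sum>\<^sub># K) $ i)"
  using assms
proof (induction K)
  case (add b K)
  have "b \<in> cell" "b \<noteq> 0" using add.prems by auto
  then obtain j where "b $ j \<noteq> 0" by (auto simp: vec_eq_iff)
  then have "1 \<le> b $ j" using cell_D(2)[OF \<open>b \<in> cell\<close>, of j] by linarith
  also have "b $ j \<le> (\<Sum>i\<in>UNIV. b $ i)"
    by (rule member_le_sum) (auto simp: cell_D[OF \<open>b \<in> cell\<close>])
  finally show ?case using add by (simp add: sum.distrib)
qed simp

lemma longest_exists:
  assumes "u \<in> orthant"
  shows "\<exists>K. longest u K"
proof -
  have u: "u \<in> L" "\<And>i. 0 \<le> u $ i" using assms by (auto simp: orthant_def)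
  \<comment> \<open>The zero vector is not admitted as a member, hence the case distinction.\<close>
  define K where "K = (if reduce u = 0 then {#} else {#reduce u#})"
  have "\<Sum>\<^sub># K = reduce u" by (simp add: K_def)
  then have "packing u K"
    using reduce_in_cell[OF u(1)] u(2)
    by (auto simp: packing_def K_def zmod_le_nonneg_dividend minus_mod_eq_mult_div)
  moreover have "size K \<le> nat (\<Sum>i\<in>UNIV. u $ i)" if "packing u K" for K
  proof -
    have "int (size K) \<le> (\<Sum>i\<in>UNIV. (\<Sum>\<^sub># K) $ i)"
      using that by (intro size_le_sum) (auto simp: packing_def)
    also have "\<dots> \<le> (\<Sum>i\<in>UNIV. u $ i)"
      using that by (intro sum_mono) (auto simp: packing_def)
    finally show ?thesis by linarith
  qed
  ultimately show ?thesis
    unfolding longest_def using ex_has_greatest_nat[of "packing u" K size] by (metis le_imp_less_Suc)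
qed

lemma slack_ge:
  assumes "packing u K" "i \<notin> tight u K"
  shows "d \<le> u $ i - (\<Sum>\<^sub># K) $ i"
proof -
  have "(\<Sum>\<^sub># K) $ i \<le> u $ i" "(\<Sum>\<^sub># K) $ i \<noteq> u $ i" "d dvd u $ i - (\<Sum>\<^sub># K) $ i"
    using assms by (auto simp: packing_def tight_def)
  then show ?thesis by (intro zdvd_imp_le) auto
qed

text \<open>
Off the tight coordinates the replacement increases the sum by a multiple of \<open>d\<close> that is less than
\<open>2 d\<close>, hence by at most \<open>d\<close>, and there the slack is at least \<open>d\<close>.
\<close>
lemma packing_replace:
  assumes K: "packing u K" and A: "A \<subseteq># K" and B: "set_mset B \<subseteq> cell - {0}"
    and dvd: "\<And>i. d dvd (\<Sum>\<^sub># B) $ i - (\<Sum>\<^sub># A) $ i"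
    and tight: "\<And>i. i \<in> tight u K \<Longrightarrow> (\<Sum>\<^sub># B) $ i = (\<Sum>\<^sub># A) $ i"
    and less: "\<And>i. (\<Sum>\<^sub># B) $ i - (\<Sum>\<^sub># A) $ i < 2 * d"
  shows "packing u (K - A + B)"
    and "(\<Sum>\<^sub># (K - A + B)) $ i = (\<Sum>\<^sub># K) $ i + ((\<Sum>\<^sub># B) $ i - (\<Sum>\<^sub># A) $ i)"
proof -
  obtain R where R: "K = A + R" using A by (auto simp: mset_subset_eq_exists_conv)
  have eq: "(\<Sum>\<^sub># (K - A + B)) $ i = (\<Sum>\<^sub># K) $ i + ((\<Sum>\<^sub># B) $ i - (\<Sum>\<^sub># A) $ i)" for i
    by (simp add: R)
  then show "(\<Sum>\<^sub># (K - A + B)) $ i = (\<Sum>\<^sub># K) $ i + ((\<Sum>\<^sub># B) $ i - (\<Sum>\<^sub># A) $ i)" .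
  have "(\<Sum>\<^sub># B) $ i - (\<Sum>\<^sub># A) $ i \<le> u $ i - (\<Sum>\<^sub># K) $ i" for i
  proof (cases "i \<in> tight u K")
    case True
    then show ?thesis using tight by (simp add: tight_def)
  next
    case False
    obtain t where t: "(\<Sum>\<^sub># B) $ i - (\<Sum>\<^sub># A) $ i = d * t" using dvd[of i] by (auto elim: dvdE)
    with less[of i] have "d * t < d * 2" by simp
    then have "t \<le> 1" using d_pos by (simp add: mult_less_cancel_left_pos)
    then have "d * t \<le> d" using d_pos by (simp add: mult_le_cancel_left1)
    then show ?thesis using t slack_ge[OF K False] by linarith
  qed
  moreover have "d dvd u $ i - (\<Sum>\<^sub># K) $ i - ((\<Sum>\<^sub># B) $ i - (\<Sum>\<^sub># A) $ i)" for i
    using K dvd[of i] dvd_diff by (force simp: packing_def)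
  ultimately show "packing u (K - A + B)"
    using K B unfolding packing_def eq by (auto simp: R algebra_simps)
qed

text \<open>
Otherwise \<open>c\<close> could be replaced by \<open>p\<close> and \<open>q\<close>, which would lengthen the packing. At a coordinate that is
not tight a carry is harmless, because it costs no more than the slack. So every member of a longest
packing is irreducible even after restriction to the tight coordinates.
\<close>
lemma longest_split:
  assumes K: "longest u K" and c: "c \<in># K" and p: "p \<in> cell - {0}" and q: "q \<in> cell - {0}"
    and dvd: "\<And>i. d dvd p $ i + q $ i - c $ i"
  shows "\<exists>i\<in>tight u K. p $ i + q $ i \<noteq> c $ i"
proof (rule ccontr)
  assume "\<not> ?thesis"
  then have eq: "i \<in> tight u K \<Longrightarrow> p $ i + q $ i = c $ i" for i by auto
  have cb: "c \<in> cell" using K c by (auto simp: longest_def packing_def)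
  have "packing u (K - {#c#} + {#p, q#})"
  proof (rule packing_replace)
    show "(\<Sum>\<^sub># {#p, q#}) $ i - (\<Sum>\<^sub># {#c#}) $ i < 2 * d" for i
      using cell_D(3)[of p i] cell_D(3)[of q i] cell_D(2)[OF cb, of i] p q by simp
  qed (use K c p q dvd eq in \<open>auto simp: longest_def add_ac\<close>)
  then have "size (K - {#c#} + {#p, q#}) \<le> size K" using K by (auto simp: longest_def)
  then show False using c by (simp add: size_Diff_singleton)
qed

text \<open>
The analogue of \<open>longest_split\<close> for \<open>c = 0\<close>, where the pair is added without removing a member.
\<close>
lemma longest_opposite:
  assumes K: "longest u K" and p: "p \<in> cell - {0}" and q: "q \<in> cell - {0}"
    and dvd: "\<And>i. d dvd p $ i + q $ i"
  shows "\<exists>i\<in>tight u K. p $ i + q $ i \<noteq> 0"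
proof (rule ccontr)
  assume "\<not> ?thesis"
  then have eq: "i \<in> tight u K \<Longrightarrow> p $ i + q $ i = 0" for i by auto
  have "packing u (K - {#} + {#p, q#})"
  proof (rule packing_replace)
    show "(\<Sum>\<^sub># {#p, q#}) $ i - (\<Sum>\<^sub># {#}) $ i < 2 * d" for i
      using cell_D(3)[of p i] cell_D(3)[of q i] p q by simp
  qed (use K p q dvd eq in \<open>auto simp: longest_def add_ac\<close>)
  then have "size (K - {#} + {#p, q#}) \<le> size K" using K unfolding longest_def by blast
  then show False by simp
qed

text \<open>
Apply \<open>longest_opposite\<close> to \<open>p\<close> and the residue vector of \<open>-p\<close>: where \<open>p\<close> vanishes, so does the latter.
Hence residue vectors are determined by their entries at the tight coordinates.
\<close>
lemma tight_separates:
  assumes K: "longest u K" and p: "p \<in> cell - {0}"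
  shows "\<exists>i\<in>tight u K. p $ i \<noteq> 0"
proof -
  define q where "q = reduce (- p)"
  have "- p \<in> L" using diff_in[OF zero_in, of p] p by (auto simp: cell_def)
  then have q: "q \<in> cell" unfolding q_def by (rule reduce_in_cell)
  have dvd: "d dvd p $ i + q $ i" for i
    by (simp add: q_def mod_add_right_eq mod_0_imp_dvd)
  have "q \<noteq> 0"
    using p dvd cell_eqI[of p 0] by (auto simp: cell_def zero_in d_pos)
  then obtain i where i: "i \<in> tight u K" "p $ i + q $ i \<noteq> 0"
    using longest_opposite[OF K p _ dvd] q by auto
  then have "p $ i \<noteq> 0" by (auto simp: q_def)
  then show ?thesis using i by auto
qed

lemma orthant_summand_cell:
  assumes "p \<in> orthant" "q \<in> orthant" "\<And>i. p $ i + q $ i < d"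
  shows "p \<in> cell"
  using assms unfolding orthant_def cell_def
  by (smt (verit) mem_Collect_eq)

lemma longest_member_irreducible:
  assumes K: "longest u K" and c: "c \<in># K"
  shows "c \<in> irreducibles orthant"
proof -
  have cb: "c \<in> cell" "c \<noteq> 0" using K c by (auto simp: longest_def packing_def)
  have "p = 0 \<or> q = 0" if p: "p \<in> orthant" and q: "q \<in> orthant" and eq: "c = p + q" for p q
  proof (rule ccontr)
    assume "\<not> ?thesis"
    moreover have "p \<in> cell" "q \<in> cell"
      using orthant_summand_cell[OF p q] orthant_summand_cell[OF q p] cell_D(3)[OF cb(1)]
      by (auto simp: eq add.commute)
    ultimately show False
      using longest_split[OF K c, of p q] by (auto simp: eq)
  qed
  then show ?thesis using cb by (auto simp: irreducibles_def orthant_def cell_def)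
qed

text \<open>
A proper decomposition of \<open>d e\<^sub>i\<close> consists of two residue vectors supported at \<open>i\<close>. Adding them to the
packing would be possible at a coordinate that is not tight. In particular \<open>d e\<^sub>i\<close> is used only if the
generator \<open>r i\<close> is primitive.
\<close>
lemma longest_axis_irreducible:
  assumes K: "longest u K" and i: "i \<notin> tight u K"
  shows "axis i d \<in> irreducibles orthant"
proof -
  have "p = 0 \<or> q = 0" if p: "p \<in> orthant" and q: "q \<in> orthant" and eq: "axis i d = p + q" for p q
  proof (rule ccontr)
    assume nz: "\<not> ?thesis"
    have s: "p $ j + q $ j = (if j = i then d else 0)" for j
      using arg_cong[OF eq, of "\<lambda>v. v $ j"] by (auto simp: axis_def split: if_splits)
    have nn: "0 \<le> p $ j" "0 \<le> q $ j" for j using p q by (auto simp: orthant_def)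
    have off: "p $ j = 0" "q $ j = 0" if "j \<noteq> i" for j
      using s[of j] nn[of j] that by auto
    have "p $ i \<noteq> 0" "q $ i \<noteq> 0"
      using nz off by (metis vec_eq_iff zero_index)+
    then have "p $ j < d" "q $ j < d" for j
      using s[of i] nn[of i] off[of j] d_pos by (cases "j = i"; force)+
    then have "p \<in> cell" "q \<in> cell" using p q nn by (auto simp: cell_def orthant_def)
    moreover have "d dvd p $ j + q $ j" for j by (simp add: s)
    ultimately obtain j where "j \<in> tight u K" "p $ j + q $ j \<noteq> 0"
      using longest_opposite[OF K, of p q] nz by auto
    then show False using i by (auto simp: s split: if_splits)
  qed
  moreover have "axis i d \<in> orthant" "axis i d \<noteq> (0 :: int ^ 'n)"
    using d_pos axis_in by (auto simp: orthant_def axis_def vec_eq_iff)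
  ultimately show ?thesis by (auto simp: irreducibles_def)
qed

text \<open>
The slack of the packing is filled with vectors \<open>d e\<^sub>i\<close>, one kind for each coordinate that is not tight.
\<close>
lemma short_if_card_le:
  assumes K: "longest u K" and card: "card (set_mset K) \<le> card (tight u K)"
  shows "\<exists>W. set_mset W \<subseteq> irreducibles orthant \<and> card (set_mset W) \<le> CARD('n) \<and> u = \<Sum>\<^sub># W"
proof -
  define c where "c i = nat ((u $ i - (\<Sum>\<^sub># K) $ i) div d)" for i
  define V where "V = (\<Sum>i\<in>- tight u K. replicate_mset (c i) (axis i d))"
  have sub: "set_mset V \<subseteq> (\<lambda>i. axis i d) ` (- tight u K)"
    by (auto simp: V_def in_replicate_mset set_mset_sum split: if_splits)
  have "card (set_mset (K + V)) \<le> card (set_mset K) + card (set_mset V)"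
    by (simp add: card_Un_le)
  also have "card (set_mset V) \<le> card (- tight u K)"
    using surj_card_le[OF _ sub] by simp
  also have "card (- tight u K) = CARD('n) - card (tight u K)"
    by (simp add: Compl_eq_Diff_UNIV card_Diff_subset)
  finally have "card (set_mset (K + V)) \<le> CARD('n)"
    using card card_mono[of UNIV "tight u K"] by simp
  moreover have "set_mset (K + V) \<subseteq> irreducibles orthant"
    using longest_member_irreducible[OF K] longest_axis_irreducible[OF K] sub by auto
  moreover have "u = \<Sum>\<^sub># (K + V)"
  proof -
    have rep: "\<Sum>\<^sub># (replicate_mset m v) = int m *s v" for m and v :: "int ^ 'n"
      by (induction m) (auto simp: vec_eq_iff algebra_simps)
    have sm: "\<Sum>\<^sub># (sum f A) = (\<Sum>i\<in>A. \<Sum>\<^sub># (f i))" if "finite A" for f :: "'n \<Rightarrow> (int ^ 'n) multiset" and A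
      using that by (induction A rule: finite_induct) auto
    have "(\<Sum>\<^sub># V) $ j = u $ j - (\<Sum>\<^sub># K) $ j" for j
    proof -
      have "(\<Sum>\<^sub># V) $ j = (\<Sum>i\<in>- tight u K. if j = i then int (c i) * d else 0)"
        unfolding V_def by (simp add: sm rep sum_component axis_def if_distrib cong: if_cong del: sum_mset_replicate_mset)
      also have "\<dots> = (if j \<in> - tight u K then int (c j) * d else 0)"
        by (subst sum.delta') auto
      also have "\<dots> = u $ j - (\<Sum>\<^sub># K) $ j"
        using K d_pos by (auto simp: tight_def c_def longest_def packing_def pos_imp_zdiv_nonneg_iff)
      finally show ?thesis .
    qed
    then show ?thesis by (simp add: vec_eq_iff)
  qed
  ultimately show ?thesis by blast
qed

text \<open>
A single exchange of \<open>p + q\<close> for \<open>r + s\<close> keeps the number of members, so the packing stays longest and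
the conclusions drawn from maximality remain available. Exchanges are repeated until \<open>p\<close> or \<open>q\<close> has
been used up, or until the slack runs out at a coordinate, which thereby becomes tight.
\<close>
lemma exchange:
  assumes "longest u K" and "p \<in># K" "q \<in># K" "p \<noteq> q"
    and r: "r \<in> cell - {0}" and s: "s \<in> cell - {0}" and "p \<notin> {r, s}" "q \<notin> {r, s}"
    and dvd: "\<And>i. d dvd (r $ i + s $ i) - (p $ i + q $ i)"
    and "\<And>i. i \<in> tight u K \<Longrightarrow> r $ i + s $ i = p $ i + q $ i"
  shows "\<exists>K'. longest u K' \<and> set_mset K' \<subseteq> set_mset K \<union> {r, s} \<and> tight u K \<subseteq> tight u K' \<and>
    (p \<notin># K' \<or> q \<notin># K' \<or> (\<exists>i \<in> tight u K' - tight u K. p $ i + q $ i < r $ i + s $ i))"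
  using assms(1-4) assms(7,8,10)
proof (induction "count K p" arbitrary: K rule: less_induct)
  case less
  have pk: "packing u K" using less.prems(1) by (simp add: longest_def)
  have pq: "p \<in> cell" "q \<in> cell" using pk less.prems by (auto simp: packing_def)
  have sub: "{#p, q#} \<subseteq># K"
    using less.prems(2-4) by (simp add: insert_subset_eq_iff in_diff_count)
  define K1 where "K1 = K - {#p, q#} + {#r, s#}"
  have "(\<Sum>\<^sub># {#r, s#}) $ i - (\<Sum>\<^sub># {#p, q#}) $ i < 2 * d" for i
    using cell_D(3)[of r i] cell_D(3)[of s i] cell_D(2)[OF pq(1), of i] cell_D(2)[OF pq(2), of i] r s
    by simp
  then have pk1: "packing u K1"
    and sum1: "\<And>i. (\<Sum>\<^sub># K1) $ i = (\<Sum>\<^sub># K) $ i + (r $ i + s $ i - (p $ i + q $ i))"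
    unfolding K1_def
    using packing_replace[OF pk sub, of "{#r, s#}"] r s dvd less.prems(7) by auto
  have "size K1 = size K"
    using size_mset_mono[OF sub] by (simp add: K1_def size_Diff_submset[OF sub])
  then have long1: "longest u K1" using pk1 less.prems(1) by (simp add: longest_def)
  have set1: "set_mset K1 \<subseteq> set_mset K \<union> {r, s}"
    by (auto simp: K1_def dest: in_diffD)
  have tight1: "tight u K \<subseteq> tight u K1"
    using less.prems(7) sum1 by (auto simp: tight_def)
  show ?case
  proof (cases "p \<notin># K1 \<or> q \<notin># K1 \<or> tight u K1 \<noteq> tight u K")
    case True
    have "p $ i + q $ i < r $ i + s $ i" if "i \<in> tight u K1 - tight u K" for i
      using slack_ge[OF pk, of i] that sum1[of i] d_pos by (auto simp: tight_def)
    then show ?thesis using True long1 set1 tight1 by blast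
  next
    case False
    have "count K1 p < count K p"
      using less.prems(2-6) by (auto simp: K1_def count_eq_zero_iff[symmetric] simp del: count_eq_zero_iff)
    then obtain K' where "longest u K'" "set_mset K' \<subseteq> set_mset K1 \<union> {r, s}" "tight u K1 \<subseteq> tight u K'"
      "p \<notin># K' \<or> q \<notin># K' \<or> (\<exists>i \<in> tight u K' - tight u K1. p $ i + q $ i < r $ i + s $ i)"
      using less.hyps[of K1] long1 False less.prems(4-7) by auto
    then show ?thesis using set1 False by blast
  qed
qed

end

section \<open>Lattices of index at most five\<close>

text \<open>
The two divisibility axioms are what the determinant says about the group of residue vectors. The
first makes it cyclic as soon as some entry equals 1. The second concerns the Klein four-group: two
vectors that are independent on a pair of coordinates then generate everything.
\<close>
locale small_lattice = scaled_lattice d L for d :: int and L :: "(int ^ 'n::finite) set" +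
  assumes d_le: "d \<le> 5"
    and unit_coordinate: "\<lbrakk>h \<in> L; h $ i = 1; u \<in> L\<rbrakk> \<Longrightarrow> d dvd u $ j - u $ i * h $ j"
    and half_coordinates: "\<lbrakk>d = 4; h \<in> L; h $ i = 2; g \<in> L; g $ i = 0; g $ j = 2;
      u \<in> L; u $ i = 0; u $ j = 0\<rbrakk> \<Longrightarrow> d dvd u $ l"
begin

definition multiple :: "int ^ 'n \<Rightarrow> int \<Rightarrow> int ^ 'n" where
  "multiple h k = reduce (k *s h)"

lemma multiple_nth [simp]: "multiple h k $ j = k * h $ j mod d"
  by (simp add: multiple_def)

lemma multiple_in_cell: "h \<in> cell \<Longrightarrow> multiple h k \<in> cell"
  unfolding multiple_def by (intro reduce_in_cell scale_in cell_D(1))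

lemma cell_eq_multiple:
  assumes "h \<in> cell" "h $ i = 1" "b \<in> cell"
  shows "b = multiple h (b $ i)"
proof (rule cell_eqI[OF assms(3) multiple_in_cell[OF assms(1)]])
  fix j
  have "d dvd b $ j - b $ i * h $ j"
    using unit_coordinate[OF cell_D(1)[OF assms(1)] assms(2) cell_D(1)[OF assms(3)]] .
  then show "d dvd b $ j - multiple h (b $ i) $ j"
    by (metis mod_eq_dvd_iff mod_mod_trivial multiple_nth)
qed

lemma multiple_nonzero:
  assumes "h \<in> cell" "h $ i = 1" "0 < k" "k < d"
  shows "multiple h k \<in> cell - {0}"
proof -
  have "multiple h k $ i \<noteq> 0" using assms by simp
  then show ?thesis using multiple_in_cell[OF assms(1)] by (metis DiffI singletonD zero_index)
qed

lemma multiple_cong: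
  assumes "a + b = (c + e :: int)"
  shows "d dvd (multiple h a $ j + multiple h b $ j) - (multiple h c $ j + multiple h e $ j)"
proof -
  have "(multiple h x $ j + multiple h y $ j) mod d = (x + y) * h $ j mod d" for x y
    by (simp add: mod_add_eq distrib_right)
  then have "(multiple h a $ j + multiple h b $ j) mod d = (multiple h c $ j + multiple h e $ j) mod d"
    using assms by metis
  then show ?thesis by (simp add: mod_eq_dvd_iff)
qed

lemma member_multiple:
  assumes K: "longest u K" and h: "h \<in> cell" "h $ i = 1" and b: "b \<in># K"
  obtains k where "0 < k" "k < d" "b = multiple h k" "b $ i = k"
proof (rule that)
  have bc: "b \<in> cell" "b \<noteq> 0" using K b by (auto simp: longest_def packing_def)
  show eq: "b = multiple h (b $ i)" using cell_eq_multiple[OF h bc(1)] .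
  have "multiple h 0 = 0" by (simp add: vec_eq_iff)
  then have "b $ i \<noteq> 0" using eq bc(2) by metis
  then show "0 < b $ i" using cell_D(2)[OF bc(1), of i] by linarith
  show "b $ i < d" using cell_D(3)[OF bc(1)] .
qed simp

text \<open>
The instance of \<open>longest_split\<close> for \<open>x\<^sub>a\<^sub>+\<^sub>b = x\<^sub>a + x\<^sub>b\<close>, valid if no carry occurs at a tight coordinate.
\<close>
lemma multiple_not_member:
  assumes K: "longest u K" and h: "h \<in> cell" "h $ i = 1"
    and ab: "0 < a" "0 < b" "a < d" "b < d"
    and eq: "\<And>j. j \<in> tight u K \<Longrightarrow> multiple h a $ j + multiple h b $ j = multiple h (a + b) $ j"
  shows "multiple h (a + b) \<notin># K"
proof
  assume "multiple h (a + b) \<in># K"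
  moreover have "d dvd multiple h a $ j + multiple h b $ j - multiple h (a + b) $ j" for j
    using multiple_cong[of a b "a + b" 0 h j] by simp
  ultimately show False
    using longest_split[OF K _ multiple_nonzero[OF h ab(1,3)] multiple_nonzero[OF h ab(2,4)]] eq by blast
qed

text \<open>
With entries 0 and 1 only, \<open>k\<close> copies of \<open>h\<close> never carry at a tight coordinate for \<open>k < d\<close>, so every
nonzero multiple other than \<open>h\<close> is reducible there.
\<close>
lemma only_generator:
  assumes K: "longest u K" and h: "h \<in> cell" "h $ i = 1"
    and le: "\<And>j. j \<in> tight u K \<Longrightarrow> h $ j \<le> 1"
  shows "set_mset K \<subseteq> {h}"
proof
  fix b assume b: "b \<in># K"
  obtain k where k: "0 < k" "k < d" "b = multiple h k" by (rule member_multiple[OF K h b])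
  have "k = 1"
  proof (rule ccontr)
    assume "k \<noteq> 1"
    have "multiple h (1 + (k - 1)) \<notin># K"
    proof (rule multiple_not_member[OF K h])
      fix j assume "j \<in> tight u K"
      then have "h $ j = 0 \<or> h $ j = 1" using le[of j] cell_D(2)[OF h(1), of j] by linarith
      then show "multiple h 1 $ j + multiple h (k - 1) $ j = multiple h (1 + (k - 1)) $ j"
        using k by auto
    qed (use k \<open>k \<noteq> 1\<close> in auto)
    then show False using b k by simp
  qed
  then show "b \<in> {h}" using k(3) cell_eq_multiple[OF h h(1)] h(2) by (metis singletonI)
qed

text \<open>
On two tight coordinates with entries \<open>(1, d - 1)\<close> the multiples \<open>(k, d - k)\<close> are all irreducible, so the
number of members cannot be bounded by splitting. But \<open>x\<^sub>1 + x\<^sub>3\<close> and \<open>2 x\<^sub>2\<close> agree there, and the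
exchange of the first for the second removes one of three members or produces a third tight coordinate.
\<close>
lemma opposite_pair:
  assumes K: "longest u K" and h: "h \<in> cell" "h $ i = 1" and j: "h $ j = d - 1" and d: "d = 4 \<or> d = 5"
    and t: "tight u K = {i, j}" and sub: "set_mset K \<subseteq> multiple h ` {1, 2, 3}"
  shows "\<exists>K. longest u K \<and> card (set_mset K) \<le> card (tight u K)"
proof -
  have ij: "i \<noteq> j"
  proof
    assume "i = j"
    then have "d - 1 = 1" using h(2) j by metis
    then show False using d by linarith
  qed
  show ?thesis
  proof (cases "card (set_mset K) \<le> 2")
    case True
    then show ?thesis using K t ij by (intro exI[of _ K]) simp
  next
    case False
    let ?p = "multiple h 1" and ?q = "multiple h 3" and ?r = "multiple h 2"
    have at_i: "?p $ i = 1" "?q $ i = 3" "?r $ i = 2" using h d by auto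
    have ne: "?p \<noteq> ?q \<and> ?p \<noteq> ?r \<and> ?q \<noteq> ?r"
      by (intro conjI notI; drule arg_cong[of _ _ "\<lambda>v. v $ i"]; simp only: at_i; simp)
    have le2: "card {a, b} \<le> 2" for a b :: "int ^ 'n" by (simp add: card_insert_if)
    have "?p \<in># K"
      using False le2[of ?q ?r] sub card_mono[of "{?q, ?r}" "set_mset K"] by fastforce
    moreover have "?q \<in># K"
      using False le2[of ?p ?r] sub card_mono[of "{?p, ?r}" "set_mset K"] by fastforce
    moreover have "?r \<in> cell - {0}" using multiple_nonzero[OF h, of 2] d by auto
    moreover have "d dvd (?r $ l + ?r $ l) - (?p $ l + ?q $ l)" for l
      by (rule multiple_cong) simp
    moreover have "?r $ l + ?r $ l = ?p $ l + ?q $ l" if "l \<in> tight u K" for l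
      using that t h j d by auto
    ultimately obtain K' where K': "longest u K'" "set_mset K' \<subseteq> set_mset K \<union> {?r, ?r}" "tight u K \<subseteq> tight u K'"
      and drop: "?p \<notin># K' \<or> ?q \<notin># K' \<or> (\<exists>i \<in> tight u K' - tight u K. ?p $ i + ?q $ i < ?r $ i + ?r $ i)"
      using exchange[OF K, of ?p ?q ?r ?r] ne by auto
    have sub': "set_mset K' \<subseteq> {?p, ?q, ?r}" using K'(2) sub by auto
    have "card {i, j} = 2" using ij by simp
    then have two: "2 \<le> card (tight u K')" using card_mono[OF _ K'(3)] t by simp
    have "card (set_mset K') \<le> card (tight u K')"
    proof (cases "tight u K' = tight u K")
      case True
      then have "set_mset K' \<subseteq> {?q, ?r} \<or> set_mset K' \<subseteq> {?p, ?r}" using drop sub' by auto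
      then have "card (set_mset K') \<le> 2"
        using card_mono[of "{?q, ?r}" "set_mset K'"] card_mono[of "{?p, ?r}" "set_mset K'"] le2
        by (meson finite.emptyI finite.insertI order_trans)
      then show ?thesis using two by simp
    next
      case False
      then have "card (tight u K) < card (tight u K')" using K'(3) by (intro psubset_card_mono) auto
      moreover have "card {?p, ?q, ?r} \<le> 3" by (simp add: card_insert_if)
      ultimately show ?thesis using card_mono[OF _ sub'] t \<open>card {i, j} = 2\<close> by simp
    qed
    then show ?thesis using K'(1) by blast
  qed
qed

text \<open>
For \<open>d = 5\<close> the sums \<open>x\<^sub>1 + x\<^sub>4\<close> and \<open>x\<^sub>2 + x\<^sub>3\<close> agree at every coordinate: both are 5 where \<open>h\<close> is nonzero.
So this exchange does not change the tight coordinates, and it must end by using up \<open>x\<^sub>1\<close> or \<open>x\<^sub>4\<close>.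
\<close>
lemma balanced_exists:
  assumes K: "longest u K" and h: "h \<in> cell" "h $ i = 1" and d: "d = 5"
  shows "\<exists>K'. longest u K' \<and> tight u K \<subseteq> tight u K' \<and> (multiple h 1 \<notin># K' \<or> multiple h 4 \<notin># K')"
proof (cases "multiple h 1 \<in># K \<and> multiple h 4 \<in># K")
  case True
  have ne: "multiple h a \<noteq> multiple h b" if "a mod 5 \<noteq> b mod 5" for a b
  proof
    assume "multiple h a = multiple h b"
    then have "multiple h a $ i = multiple h b $ i" by simp
    then show False using that unfolding multiple_nth unfolding h d by simp
  qed
  have eq: "multiple h 2 $ l + multiple h 3 $ l = multiple h 1 $ l + multiple h 4 $ l" for l
  proof -
    have "h $ l \<in> {0, 1, 2, 3, 4}" using cell_D(2,3)[OF h(1), of l] d by auto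
    then show ?thesis unfolding multiple_nth unfolding d by auto
  qed
  show ?thesis
    using exchange[OF K, of "multiple h 1" "multiple h 4" "multiple h 2" "multiple h 3"] True ne eq
      multiple_nonzero[OF h, of 2] multiple_nonzero[OF h, of 3] d
    by fastforce
qed (use K in blast)

text \<open>
After balancing there are at most three different members, and at most \<open>d - 1\<close>. So three tight
coordinates suffice, and one tight coordinate leaves only the generator \<open>h\<close>. With two of them, \<open>i\<close>
and \<open>j\<close>, the entry of \<open>h\<close> at \<open>j\<close> decides which multiples are irreducible.
\<close>
lemma cyclic_case:
  assumes K0: "longest u K0" and i0: "i \<in> tight u K0" and h: "h \<in> cell" "h $ i = 1"
  shows "\<exists>K. longest u K \<and> card (set_mset K) \<le> card (tight u K)"
proof -
  obtain K where K: "longest u K" and i: "i \<in> tight u K"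
    and bal: "d = 5 \<Longrightarrow> multiple h 1 \<notin># K \<or> multiple h 4 \<notin># K"
    using balanced_exists[OF K0 h] K0 i0 by (cases "d = 5") auto
  note mem = member_multiple[OF K h]
  have d1: "1 < d" using h cell_D(3)[OF h(1), of i] by simp
  have sub: "set_mset K \<subseteq> multiple h ` {1..d - 1}"
    using mem by (smt (verit) atLeastAtMost_iff image_eqI subsetI)
  have le3: "card (set_mset K) \<le> 3 \<and> card (set_mset K) \<le> nat (d - 1)"
  proof -
    have le: "card (set_mset K) \<le> card A" if "set_mset K \<subseteq> multiple h ` A" "finite A" for A
      using surj_card_le[OF that(2,1)] .
    have "set_mset K \<subseteq> multiple h ` {2, 3, 4} \<or> set_mset K \<subseteq> multiple h ` {1, 2, 3}" if "d = 5"
    proof -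
      have "{1..d - 1} = {1, 2, 3, 4}" using that by auto
      then show ?thesis using sub bal[OF that] by auto
    qed
    then have "card (set_mset K) \<le> 3" if "d = 5"
      using le[of "{2, 3, 4}"] le[of "{1, 2, 3}"] that by auto
    moreover have "card (set_mset K) \<le> nat (d - 1)" using le[OF sub] by simp
    ultimately show ?thesis using d_le by (cases "d = 5"; linarith)
  qed
  have "card (tight u K) \<noteq> 0" using i by auto
  then consider "3 \<le> card (tight u K)" | "card (tight u K) = 1" | "card (tight u K) = 2"
    by linarith
  then show ?thesis
  proof cases
    case 1
    then show ?thesis using K le3 by (intro exI[of _ K]) simp
  next
    case 2
    then have "tight u K = {i}" using i by (metis card_1_singletonE singletonD)
    then have "set_mset K \<subseteq> {h}" using h by (intro only_generator[OF K h]) auto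
    then have "card (set_mset K) \<le> 1" using card_mono[of "{h}" "set_mset K"] by simp
    then show ?thesis using K 2 by (intro exI[of _ K]) simp
  next
    case 3
    then obtain j where t: "tight u K = {i, j}" and ij: "i \<noteq> j"
      using i by (metis card_2_iff doubleton_eq_iff insertE singletonD)
    have hj: "0 \<le> h $ j" "h $ j < d" using cell_D[OF h(1)] by auto
    have two: ?thesis if "card (set_mset K) \<le> 2" using that K 3 by (intro exI[of _ K]) simp
    have le2: "card (set_mset K) \<le> 2" if "set_mset K \<subseteq> multiple h ` {a, b}" for a b
      using surj_card_le[OF _ that] by (auto simp: card_insert_if split: if_splits)
    have notin: "multiple h (a + b) \<notin># K"
      if "0 < a" "0 < b" "a + b < d" "(a * h $ j) mod d + (b * h $ j) mod d = ((a + b) * h $ j) mod d" for a b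
      using that by (intro multiple_not_member[OF K h]) (auto simp: t h)
    consider "h $ j \<le> 1" | "d \<le> 3" | "d = 4" "h $ j = 2" | "d = 5" "h $ j = 2" | "d = 5" "h $ j = 3"
      | "d = 4" "h $ j = 3" | "d = 5" "h $ j = 4"
      using hj d_le by linarith
    then show ?thesis
    proof cases
      case 1
      then have "set_mset K \<subseteq> {h}" using h t by (intro only_generator[OF K h]) auto
      then show ?thesis using two card_mono[of "{h}" "set_mset K"] by simp
    next
      case 2
      then show ?thesis using le3 by (intro two) linarith
    next
      case 3
      have "{1..d - 1} = {1, 2, 3}" using 3 by auto
      moreover have "multiple h 3 \<notin># K" using notin[of 1 2] 3 by simp
      ultimately have "set_mset K \<subseteq> multiple h ` {1, 2}" using sub by auto
      then show ?thesis using two le2 by blast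
    next
      case 4
      have "{1..d - 1} = {1, 2, 3, 4}" using 4 by auto
      moreover have "multiple h 2 \<notin># K" "multiple h 4 \<notin># K" using notin[of 1 1] notin[of 1 3] 4 by simp_all
      ultimately have "set_mset K \<subseteq> multiple h ` {1, 3}" using sub by auto
      then show ?thesis using two le2 by blast
    next
      case 5
      have "{1..d - 1} = {1, 2, 3, 4}" using 5 by auto
      moreover have "multiple h 3 \<notin># K" "multiple h 4 \<notin># K" using notin[of 1 2] notin[of 2 2] 5 by simp_all
      ultimately have "set_mset K \<subseteq> multiple h ` {1, 2}" using sub by auto
      then show ?thesis using two le2 by blast
    next
      case 6
      have "{1..d - 1} = {1, 2, 3}" using 6 by auto
      then show ?thesis using opposite_pair[OF K h _ _ t] 6 sub by simp
    next
      case 7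
      have A: "{1..d - 1} = {1, 2, 3, 4}" using 7 by auto
      from bal[OF 7(1)] show ?thesis
      proof
        assume "multiple h 4 \<notin># K"
        then have "set_mset K \<subseteq> multiple h ` {1, 2, 3}" using sub A by auto
        then show ?thesis using opposite_pair[OF K h _ _ t] 7 by simp
      next
        \<comment> \<open>Exchanging the roles of \<open>i\<close> and \<open>j\<close> makes \<open>x\<^sub>4\<close> the generator, and \<open>x\<^sub>4, x\<^sub>3, x\<^sub>2\<close> are its first three multiples.\<close>
        assume "multiple h 1 \<notin># K"
        then have "set_mset K \<subseteq> multiple h ` {2, 3, 4}" using sub A by auto
        moreover have "multiple (multiple h 4) k = multiple h (4 * k)" for k
          by (simp add: vec_eq_iff mod_mult_right_eq mult_ac)
        moreover have "multiple h (m + 5 * k) = multiple h m" for m k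
          unfolding vec_eq_iff multiple_nth unfolding 7(1) by (simp add: distrib_right mult.assoc)
        from this[of 3 1] this[of 2 2] have "multiple h 8 = multiple h 3" "multiple h 12 = multiple h 2"
          by simp_all
        ultimately have "set_mset K \<subseteq> multiple (multiple h 4) ` {1, 2, 3}"
          by auto
        moreover have "multiple h 4 $ j = 1" "multiple h 4 $ i = d - 1"
          unfolding multiple_nth unfolding h 7 by simp_all
        moreover have "tight u K = {j, i}" using t by auto
        ultimately show ?thesis
          using opposite_pair[OF K multiple_in_cell[OF h(1), of 4], of j i] 7(1) by blast
      qed
    qed
  qed
qed

lemma unit_coordinate_exists:
  assumes p: "p \<in> L" and cop: "coprime (p $ i) d" and d: "1 < d"
  shows "\<exists>h\<in>cell. h $ i = 1"
proof -
  obtain s t where "s * p $ i + t * d = 1" using bezout_int[of "p $ i" d] cop by auto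
  then have "s * p $ i mod d = 1" using d by (metis mod_mult_self1 mod_pos_pos_trivial zero_le_one mult.commute)
  then show ?thesis
    using reduce_in_cell[OF scale_in[OF p], of s] by (intro bexI[of _ "reduce (s *s p)"]) auto
qed

text \<open>
If a second vector \<open>g\<close> vanishes at \<open>i\<close>, it is nonzero at another tight coordinate \<open>j\<close>, and residue vectors
are determined by their entries in \<open>{0, 2}\<close> at \<open>i\<close> and \<open>j\<close>. Hence there are at most three members, and if no
further coordinate is tight, \<open>(2, 2) = (0, 2) + (2, 0)\<close> is reducible. Without such \<open>g\<close> the entry at \<open>i\<close>
alone determines the vector.
\<close>
lemma klein_case:
  assumes K: "longest u K" and d: "d = 4"
    and ev: "\<And>p i. \<lbrakk>p \<in> cell; i \<in> tight u K\<rbrakk> \<Longrightarrow> p $ i = 0 \<or> p $ i = 2"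
    and h: "h \<in> cell" "h $ i = 2" and i: "i \<in> tight u K"
  shows "card (set_mset K) \<le> card (tight u K)"
proof (cases "\<exists>g\<in>cell - {0}. g $ i = 0")
  case True
  then obtain g where g: "g \<in> cell" "g \<noteq> 0" "g $ i = 0" by auto
  obtain j where j: "j \<in> tight u K" "g $ j \<noteq> 0" using tight_separates[OF K, of g] g by auto
  then have gj: "g $ j = 2" using ev[OF g(1)] by auto
  have ij: "i \<noteq> j" using g gj by auto
  have inj: "b = c" if "b \<in> cell" "c \<in> cell" "b $ i = c $ i" "b $ j = c $ j" for b c
  proof (rule cell_eqI[OF that(1,2)])
    show "d dvd b $ l - c $ l" for l
      using half_coordinates[OF d cell_D(1)[OF h(1)] h(2) cell_D(1)[OF g(1)] g(3) gj, of "b - c" l]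
        diff_in[of b c] that cell_D(1) by simp
  qed
  define f where "f = (\<lambda>b :: int ^ 'n. (b $ i, b $ j))"
  have mem: "b \<in> cell" "b \<noteq> 0" if "b \<in># K" for b using K that by (auto simp: longest_def packing_def)
  have injf: "inj_on f (set_mset K)" using inj mem by (auto simp: inj_on_def f_def)
  have z: "0 \<in> cell" using d_pos by (simp add: cell_def zero_in)
  have img: "f ` set_mset K \<subseteq> {(2, 0), (0, 2), (2, 2)}"
  proof
    fix x assume "x \<in> f ` set_mset K"
    then obtain b where b: "b \<in># K" "x = f b" by auto
    have "b $ i = 0 \<or> b $ i = 2" "b $ j = 0 \<or> b $ j = 2" using ev mem b i j by auto
    moreover have "\<not> (b $ i = 0 \<and> b $ j = 0)" using inj[OF mem(1)[OF b(1)] z] mem(2)[OF b(1)] by auto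
    ultimately show "x \<in> {(2, 0), (0, 2), (2, 2)}" by (auto simp: b f_def)
  qed
  have two: "2 \<le> card (tight u K)" using card_mono[of "tight u K" "{i, j}"] i j ij by simp
  show ?thesis
  proof (cases "tight u K = {i, j}")
    case True
    have "(2, 2) \<notin> f ` set_mset K"
    proof
      assume "(2, 2) \<in> f ` set_mset K"
      then obtain c where c: "c \<in># K" "c $ i = 2" "c $ j = 2" by (auto simp: f_def)
      \<comment> \<open>The complement of \<open>g\<close> in \<open>c\<close> has entries \<open>(2, 0)\<close>, so \<open>g + q\<close> equals \<open>c\<close> at both tight coordinates.\<close>
      define q where "q = reduce (c - g)"
      have q: "q \<in> cell" unfolding q_def
        by (intro reduce_in_cell diff_in cell_D(1) mem c g)
      have "q $ i = 2" "q $ j = 0" unfolding q_def reduce_nth unfolding d by (simp_all add: c g gj)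
      moreover have "d dvd g $ l + q $ l - c $ l" for l
        unfolding q_def by (simp add: mod_eq_dvd_iff[symmetric] mod_simps)
      moreover have "q \<noteq> 0" using \<open>q $ i = 2\<close> by auto
      ultimately show False
        using longest_split[OF K c(1), of g q] g gj q c True by auto
    qed
    then have "f ` set_mset K \<subseteq> {(2, 0), (0, 2)}" using img by auto
    then have "card (f ` set_mset K) \<le> card {(2 :: int, 0 :: int), (0, 2)}" by (intro card_mono) auto
    then show ?thesis using two card_image[OF injf] by simp
  next
    case False
    then have "card {i, j} < card (tight u K)" using i j by (intro psubset_card_mono) auto
    moreover have "card (f ` set_mset K) \<le> card {(2 :: int, 0 :: int), (0, 2), (2, 2)}"
      using img by (intro card_mono) auto
    ultimately show ?thesis using ij card_image[OF injf] by simp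
  qed
next
  case False
  have "b = c" if "b \<in># K" "c \<in># K" for b c
  proof -
    have bc: "b \<in> cell - {0}" "c \<in> cell - {0}" using K that by (auto simp: longest_def packing_def)
    have "b $ i = 2" "c $ i = 2" using ev[of b i] ev[of c i] bc False i by auto
    moreover have "reduce (b - c) \<in> cell" using bc cell_D(1) by (intro reduce_in_cell diff_in) auto
    ultimately have "reduce (b - c) = 0" using False by force
    then have "d dvd b $ l - c $ l" for l
      by (metis dvd_eq_mod_eq_0 reduce_nth vector_minus_component zero_index)
    then show "b = c" using bc by (intro cell_eqI) auto
  qed
  then have "card (set_mset K) \<le> 1" by (simp add: card_le_Suc0_iff_eq)
  moreover have "tight u K \<noteq> {}" using i by auto
  then have "0 < card (tight u K)" by (simp add: card_gt_0_iff)
  ultimately show ?thesis by linarith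
qed

lemma sum_of_few_irreducibles:
  assumes "u \<in> orthant"
  shows "\<exists>W. set_mset W \<subseteq> irreducibles orthant \<and> card (set_mset W) \<le> CARD('n) \<and> u = \<Sum>\<^sub># W"
proof -
  obtain K where K: "longest u K" using longest_exists[OF assms] by auto
  consider (empty) "K = {#}" | (unit) i h where "i \<in> tight u K" "h \<in> cell" "h $ i = 1"
    | (even) i h where "d = 4" "\<And>p i. \<lbrakk>p \<in> cell; i \<in> tight u K\<rbrakk> \<Longrightarrow> p $ i = 0 \<or> p $ i = 2"
        "i \<in> tight u K" "h \<in> cell" "h $ i = 2"
  proof (cases "K = {#}")
    case False
    then obtain p where "p \<in># K" by auto
    then have p: "p \<in> cell - {0}" using K by (auto simp: longest_def packing_def)
    obtain i where i: "i \<in> tight u K" "p $ i \<noteq> 0" using tight_separates[OF K p] by auto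
    have range: "0 < p $ i" "p $ i < d" using p i cell_D(2,3)[of p i] by auto
    have d: "1 < d" using range by linarith
    show ?thesis
    proof (cases "\<exists>p\<in>cell. \<exists>i\<in>tight u K. coprime (p $ i) d")
      case True
      then show ?thesis using unit_coordinate_exists[OF cell_D(1) _ d] unit by blast
    next
      case False
      \<comment> \<open>Among \<open>0 < p $ i < d \<le> 5\<close> only the pair \<open>2 < 4\<close> is not coprime.\<close>
      then have "\<not> coprime (p $ i) d" using p i by auto
      moreover have "p $ i \<in> {1, 2, 3, 4}" "d \<in> {2, 3, 4, 5}" using range d d_le by auto
      moreover have "coprime 3 (5 :: int)" "coprime 4 (5 :: int)"
        by (simp_all add: coprime_iff_gcd_eq_1 gcd_non_0_int)
      ultimately have d4: "d = 4" using range by auto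
      have "q $ j = 0 \<or> q $ j = 2" if "q \<in> cell" "j \<in> tight u K" for q j
      proof -
        have "\<not> coprime (q $ j) 4" using False that d4 by auto
        moreover have "q $ j \<in> {0, 1, 2, 3}" using cell_D(2,3)[OF that(1), of j] d4 by auto
        moreover have "coprime 3 (4 :: int)" by (simp add: coprime_iff_gcd_eq_1 gcd_non_0_int)
        ultimately show ?thesis by auto
      qed
      then show ?thesis using even[OF d4 _ i(1), of p] p i by blast
    qed
  qed
  then have "\<exists>K. longest u K \<and> card (set_mset K) \<le> card (tight u K)"
  proof cases
    case empty
    then show ?thesis using K by auto
  next
    case unit
    then show ?thesis using cyclic_case[OF K] by blast
  next
    case even
    then show ?thesis using klein_case[OF K] K by blast
  qed
  then show ?thesis using short_if_card_le by blast
qed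

end

section \<open>Determinants\<close>

definition columns_matrix :: "('n \<Rightarrow> real ^ 'n) \<Rightarrow> real ^ 'n ^ 'n::finite" where
  "columns_matrix r = (\<chi> i j. r j $ i)"

lemma columns_matrix_mult: "columns_matrix r *v x = (\<Sum>j\<in>UNIV. x $ j *\<^sub>R r j)"
  by (simp add: columns_matrix_def matrix_vector_mult_def vec_eq_iff sum_component mult.commute)

lemma det_columns_Ints:
  assumes "\<And>j. r j \<in> int_vectors"
  shows "det (columns_matrix r) \<in> \<int>"
proof -
  have "r j $ i \<in> \<int>" for i j using assms by (auto simp: int_vectors_def)
  then show ?thesis
    unfolding det_def columns_matrix_def by (auto intro!: Ints_sum Ints_mult Ints_prod)
qed

text \<open>
Cramer's rule, in the form that exchanges a generator for a vector given by its coordinates. Its use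
is to reach determinant \<open>\<plusminus>1\<close> by replacing generators with suitable integer vectors: with respect to
such a basis all integer vectors have integer coordinates.
\<close>
lemma det_replace_column:
  "det (columns_matrix (r(k := \<Sum>j\<in>UNIV. x j *\<^sub>R r j))) = x k * det (columns_matrix r)"
proof -
  have "columns_matrix (r(k := \<Sum>j\<in>UNIV. x j *\<^sub>R r j)) =
      (\<chi> i j. if j = k then (columns_matrix r *v (\<chi> j. x j)) $ i else columns_matrix r $ i $ j)"
    unfolding columns_matrix_mult by (simp add: columns_matrix_def vec_eq_iff)
  then show ?thesis using cramer_lemma[of k "columns_matrix r" "\<chi> j. x j"] by simp
qed

lemma coordinate_times_det_Ints:
  assumes "\<And>j. r j \<in> int_vectors" "(\<Sum>j\<in>UNIV. x j *\<^sub>R r j) \<in> int_vectors"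
  shows "x k * det (columns_matrix r) \<in> \<int>"
  unfolding det_replace_column[symmetric] by (rule det_columns_Ints) (use assms in auto)

lemma coordinates_exist:
  assumes "det (columns_matrix r) \<noteq> 0"
  shows "\<exists>x. z = (\<Sum>j\<in>UNIV. x j *\<^sub>R r j)"
proof -
  obtain x where "columns_matrix r *v x = z" using cramer[OF assms, of _ z] by blast
  then show ?thesis by (intro exI[of _ "\<lambda>j. x $ j"]) (simp add: columns_matrix_mult)
qed

lemma coordinates_unique:
  assumes "det (columns_matrix r) \<noteq> 0" "(\<Sum>j\<in>UNIV. x j *\<^sub>R r j) = (\<Sum>j\<in>UNIV. y j *\<^sub>R r j)"
  shows "x k = y k"
  using det_replace_column[of r k x] det_replace_column[of r k y] assms by simp

lemma inj_if_det_nonzero: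
  assumes "det (columns_matrix r) \<noteq> 0" shows "inj r"
proof (rule injI, rule ccontr)
  fix i j assume eq: "r i = r j" and ne: "i \<noteq> j"
  have axis: "(\<Sum>l\<in>UNIV. (if l = m then 1 else 0) *\<^sub>R r l) = r m" for m
    by (simp add: if_distrib[of "\<lambda>c. c *\<^sub>R _"] cong: if_cong)
  have "(\<Sum>l\<in>UNIV. (if l = i then 1 else 0) *\<^sub>R r l) = (\<Sum>l\<in>UNIV. (if l = j then 1 else 0) *\<^sub>R r l)"
    unfolding axis by (rule eq)
  from coordinates_unique[OF assms this, of i] ne show False by simp
qed

lemma int_vectors_diff: "x \<in> int_vectors \<Longrightarrow> y \<in> int_vectors \<Longrightarrow> x - y \<in> int_vectors"
  by (auto simp: int_vectors_def)

section \<open>Scaled coordinates\<close>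

definition from_scaled :: "('n \<Rightarrow> real ^ 'n) \<Rightarrow> int \<Rightarrow> int ^ 'n \<Rightarrow> real ^ 'n::finite" where
  "from_scaled r d u = (\<Sum>j\<in>UNIV. (of_int (u $ j) / of_int d) *\<^sub>R r j)"

lemma from_scaled_add: "from_scaled r d (u + v) = from_scaled r d u + from_scaled r d v"
  by (simp add: from_scaled_def sum.distrib add_divide_distrib scaleR_add_left)

lemma from_scaled_diff: "from_scaled r d (u - v) = from_scaled r d u - from_scaled r d v"
  by (simp add: from_scaled_def sum_subtractf diff_divide_distrib scaleR_diff_left)

lemma from_scaled_axis: "d \<noteq> 0 \<Longrightarrow> from_scaled r d (axis i d) = r i"
  by (simp add: from_scaled_def axis_def if_distrib if_distribR cong: if_cong)

lemma from_scaled_replace: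
  assumes "u $ i = 0"
  shows "from_scaled (r(i := v)) d u = from_scaled r d u"
  unfolding from_scaled_def by (rule sum.cong) (auto simp: assms)

lemma det_replace_from_scaled:
  "det (columns_matrix (r(i := from_scaled r d u))) = of_int (u $ i) / of_int d * det (columns_matrix r)"
  unfolding from_scaled_def by (rule det_replace_column)

lemma dvd_if_det_one:
  assumes r: "\<And>j. r j \<in> int_vectors" and det: "\<bar>det (columns_matrix r)\<bar> = 1"
    and u: "from_scaled r d u \<in> int_vectors" and d: "0 < d"
  shows "d dvd u $ j"
proof -
  have "of_int (u $ j) / of_int d * det (columns_matrix r) \<in> \<int>"
    using coordinate_times_det_Ints[of r "\<lambda>j. of_int (u $ j) / of_int d" j] r u
    by (simp add: from_scaled_def)
  then have "(of_int (u $ j) / of_int d :: real) \<in> \<int>"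
    using det by (auto simp: abs_if split: if_splits)
  then obtain m where "of_int (u $ j) / of_int d = (of_int m :: real)" by (auto elim: Ints_cases)
  then have "(of_int (u $ j) :: real) = of_int (d * m)" using d by (simp add: field_simps)
  then have "u $ j = d * m" by (simp only: of_int_eq_iff)
  then show ?thesis by simp
qed

definition scaled_points :: "('n \<Rightarrow> real ^ 'n) \<Rightarrow> int \<Rightarrow> (int ^ 'n::finite) set" where
  "scaled_points r d = {u. from_scaled r d u \<in> int_vectors}"

text \<open>
An entry 1 at \<open>i\<close> stands for the coordinate \<open>1/d\<close>, so replacing \<open>r i\<close> by \<open>h\<close> gives determinant \<open>\<plusminus>1\<close>, and
subtracting a multiple of \<open>h\<close> from \<open>u\<close> achieves the entry 0 at \<open>i\<close>. For \<open>d = 4\<close> two replacements with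
coordinate \<open>2/4\<close> have the same effect.
\<close>
lemma small_lattice_scaled_points:
  fixes r :: "'n::finite \<Rightarrow> real ^ 'n"
  assumes r: "\<And>j. r j \<in> int_vectors" and det: "\<bar>det (columns_matrix r)\<bar> = of_int d"
    and d: "0 < d" "d \<le> 5"
  shows "small_lattice d (scaled_points r d)"
proof -
  interpret scaled_lattice d "scaled_points r d"
    by unfold_locales (use r d in \<open>auto simp: scaled_points_def from_scaled_diff from_scaled_axis int_vectors_diff\<close>)
  show ?thesis
  proof
    show "d \<le> 5" by fact
    fix h u i j
    assume h: "h \<in> scaled_points r d" "h $ i = 1" and u: "u \<in> scaled_points r d"
    let ?r = "r(i := from_scaled r d h)" and ?w = "u - u $ i *s h"
    have "?w \<in> scaled_points r d" using h u by (intro diff_in scale_in)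
    moreover have "?w $ i = 0" using h by simp
    ultimately have "from_scaled ?r d ?w \<in> int_vectors"
      by (simp only: from_scaled_replace scaled_points_def mem_Collect_eq)
    moreover have "\<bar>det (columns_matrix ?r)\<bar> = 1"
      using det d h by (simp add: det_replace_from_scaled abs_mult)
    moreover have "?r j \<in> int_vectors" for j using r h by (simp add: scaled_points_def)
    ultimately have "d dvd ?w $ j" using d by (intro dvd_if_det_one[of ?r])
    then show "d dvd u $ j - u $ i * h $ j" by simp
  next
    fix h g u i j l
    assume d4: "d = 4" and h: "h \<in> scaled_points r d" "h $ i = 2"
      and g: "g \<in> scaled_points r d" "g $ i = 0" "g $ j = 2"
      and u: "u \<in> scaled_points r d" "u $ i = 0" "u $ j = 0"
    let ?r = "r(i := from_scaled r d h)" and ?s = "r(i := from_scaled r d h, j := from_scaled r d g)"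
    have s: "?s = ?r(j := from_scaled ?r d g)" by (simp add: from_scaled_replace g)
    have "\<bar>det (columns_matrix ?s)\<bar> = 1"
      unfolding s det_replace_from_scaled using det d4 h g by (simp add: abs_mult)
    moreover have "from_scaled ?s d u \<in> int_vectors"
      using u by (simp add: from_scaled_replace scaled_points_def)
    moreover have "?s j \<in> int_vectors" for j using r h g by (simp add: scaled_points_def)
    ultimately show "d dvd u $ l" using d by (intro dvd_if_det_one[of ?s])
  qed
qed

lemma pos_range:
  assumes "inj (r :: 'n::finite \<Rightarrow> 'a::real_vector)"
  shows "pos (range r) = {\<Sum>j\<in>UNIV. x j *\<^sub>R r j | x. \<forall>j. 0 \<le> x j}"
proof (intro equalityI subsetI)
  fix z assume "z \<in> pos (range r)"
  then obtain S c where S: "finite S" "S \<subseteq> range r" "\<forall>x\<in>S. 0 \<le> c x" and z: "z = (\<Sum>x\<in>S. c x *\<^sub>R x)"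
    by (auto simp: pos_def)
  define y where "y j = (if r j \<in> S then c (r j) else 0)" for j
  have "z = (\<Sum>x\<in>range r. (if x \<in> S then c x else 0) *\<^sub>R x)"
    unfolding z using S by (intro sum.mono_neutral_cong_left) auto
  also have "\<dots> = (\<Sum>j\<in>UNIV. y j *\<^sub>R r j)"
    by (simp add: sum.reindex[OF assms] y_def)
  finally show "z \<in> {\<Sum>j\<in>UNIV. x j *\<^sub>R r j | x. \<forall>j. 0 \<le> x j}"
    using S by (auto simp: y_def intro!: exI[of _ y])
next
  fix z assume "z \<in> {\<Sum>j\<in>UNIV. x j *\<^sub>R r j | x. \<forall>j. 0 \<le> x j}"
  then obtain x where x: "\<forall>j. 0 \<le> x j" "z = (\<Sum>j\<in>UNIV. x j *\<^sub>R r j)" by auto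
  have "z = (\<Sum>v\<in>range r. x (inv r v) *\<^sub>R v)"
    using assms by (simp add: sum.reindex x(2))
  then show "z \<in> pos (range r)" unfolding pos_def using x(1)
    by (intro CollectI exI[of _ "range r"] exI[of _ "\<lambda>v. x (inv r v)"]) auto
qed

lemma integer_points_eq:
  fixes r :: "'n::finite \<Rightarrow> real ^ 'n"
  assumes r: "\<And>j. r j \<in> int_vectors" and det: "\<bar>det (columns_matrix r)\<bar> = of_int d" and d: "0 < d"
  shows "pos (range r) \<inter> int_vectors = from_scaled r d ` {u \<in> scaled_points r d. \<forall>i. 0 \<le> u $ i}"
proof (intro equalityI subsetI)
  have nz: "det (columns_matrix r) \<noteq> 0" using det d by auto
  note pos = pos_range[OF inj_if_det_nonzero[OF nz]]
  {
    fix z assume z: "z \<in> pos (range r) \<inter> int_vectors"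
    then obtain x where x: "\<And>j. 0 \<le> x j" "z = (\<Sum>j\<in>UNIV. x j *\<^sub>R r j)" by (auto simp: pos)
    have "\<exists>m. x j * of_int d = of_int m" for j
    proof -
      have "x j * det (columns_matrix r) \<in> \<int>" using coordinate_times_det_Ints[of r x j] r z x(2) by blast
      then have "x j * \<bar>det (columns_matrix r)\<bar> \<in> \<int>" by (auto simp: abs_if)
      then show ?thesis using det by (auto elim: Ints_cases)
    qed
    then obtain m where m: "\<And>j. x j * of_int d = of_int (m j)" by metis
    define u :: "int ^ 'n" where "u = (\<chi> j. m j)"
    have xu: "x j = of_int (u $ j) / of_int d" for j using m[of j] d by (simp add: u_def field_simps)
    have eq: "z = from_scaled r d u" by (simp add: from_scaled_def x(2) xu)
    moreover have "0 \<le> u $ j" for j using x(1)[of j] d by (simp add: xu zero_le_divide_iff)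
    ultimately show "z \<in> from_scaled r d ` {u \<in> scaled_points r d. \<forall>i. 0 \<le> u $ i}"
      using z by (auto simp: scaled_points_def)
  next
    fix z assume "z \<in> from_scaled r d ` {u \<in> scaled_points r d. \<forall>i. 0 \<le> u $ i}"
    then obtain u where u: "\<forall>i. 0 \<le> u $ i" "from_scaled r d u \<in> int_vectors" and z: "z = from_scaled r d u"
      by (auto simp: scaled_points_def)
    then have "z \<in> pos (range r)" unfolding pos using d
      by (auto simp: from_scaled_def intro!: exI[of _ "\<lambda>j. of_int (u $ j) / of_int d"])
    then show "z \<in> pos (range r) \<inter> int_vectors" using u z by simp
  }
qed

section \<open>Hilbert bases\<close>

text \<open>
In a representation of an irreducible \<open>z\<close> split off one copy of a generator that occurs in it: the
remaining sum must vanish.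
\<close>
lemma irreducibles_subset_generating:
  assumes zero: "0 \<in> C \<inter> int_vectors"
    and add: "\<And>x y. x \<in> C \<inter> int_vectors \<Longrightarrow> y \<in> C \<inter> int_vectors \<Longrightarrow> x + y \<in> C \<inter> int_vectors"
    and H: "int_generating C H"
  shows "irreducibles (C \<inter> int_vectors) \<subseteq> H"
proof
  let ?M = "C \<inter> int_vectors"
  fix z assume z: "z \<in> irreducibles ?M"
  then have "z \<in> ?M" "z \<noteq> 0" by (auto simp: irreducibles_def)
  then obtain S c where S: "finite S" "S \<subseteq> H" and zs: "z = (\<Sum>x\<in>S. real (c x) *\<^sub>R x)"
    using H by (auto simp: int_generating_def nonneg_int_combinations_def)
  obtain x where x: "x \<in> S" "c x \<noteq> 0" "x \<noteq> 0"
    using \<open>z \<noteq> 0\<close> by (metis (no_types, lifting) zs of_nat_0 scaleR_eq_0_iff sum.neutral)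
  have HM: "S \<subseteq> ?M" using S H by (auto simp: int_generating_def)
  have mult: "real m *\<^sub>R v \<in> ?M" if "v \<in> ?M" for m v
    using that zero add by (induction m) (auto simp: scaleR_add_left)
  have sums: "(\<Sum>v\<in>T. real (c v) *\<^sub>R v) \<in> ?M" if "T \<subseteq> S" for T
    using finite_subset[OF that S(1)] that
  proof (induction T rule: finite_induct)
    case (insert v T)
    then show ?case using add[OF mult[of v "c v"] insert.IH] HM by auto
  qed (use zero in simp)
  obtain m where m: "c x = Suc m" using x by (cases "c x") auto
  let ?rest = "real m *\<^sub>R x + (\<Sum>v\<in>S - {x}. real (c v) *\<^sub>R v)"
  have "z = x + ?rest"
    unfolding zs by (subst sum.remove[OF S(1) x(1)]) (simp add: m scaleR_add_left)
  moreover have "?rest \<in> ?M" using add[OF mult[of x m] sums[of "S - {x}"]] HM x by auto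
  ultimately have "?rest = 0" using z x HM by (auto simp: irreducibles_def)
  then have "z = x" using \<open>z = x + ?rest\<close> by simp
  then show "z \<in> H" using x S by auto
qed

text \<open>
The irreducible elements are contained in every generating set, so if they generate they are the
least generating set, and there is no other minimal one.
\<close>
lemma hilbert_basis_eq_irreducibles:
  assumes zero: "0 \<in> C \<inter> int_vectors"
    and add: "\<And>x y. x \<in> C \<inter> int_vectors \<Longrightarrow> y \<in> C \<inter> int_vectors \<Longrightarrow> x + y \<in> C \<inter> int_vectors"
    and gen: "C \<inter> int_vectors \<subseteq> nonneg_int_combinations (irreducibles (C \<inter> int_vectors))"
  shows "hilbert_basis C = irreducibles (C \<inter> int_vectors)"
proof -
  note sub = irreducibles_subset_generating[OF zero add]
  have I: "int_generating C (irreducibles (C \<inter> int_vectors))"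
    using gen by (auto simp: int_generating_def irreducibles_def)
  show ?thesis unfolding hilbert_basis_def
  proof (rule the_equality)
    show "int_generating C (irreducibles (C \<inter> int_vectors)) \<and>
      (\<forall>H'. int_generating C H' \<and> H' \<subseteq> irreducibles (C \<inter> int_vectors) \<longrightarrow> H' = irreducibles (C \<inter> int_vectors))"
      using I sub by blast
  next
    fix H assume "int_generating C H \<and> (\<forall>H'. int_generating C H' \<and> H' \<subseteq> H \<longrightarrow> H' = H)"
    then show "H = irreducibles (C \<inter> int_vectors)" using I sub by blast
  qed
qed

text \<open>
Passes from multisets, in which the packing argument counts, to sums with coefficients over the
distinct members.
\<close>
lemma hom_sum_mset:
  fixes f :: "'a::comm_monoid_add \<Rightarrow> 'b::real_vector"
  assumes zero: "f 0 = 0" and add: "\<And>x y. f (x + y) = f x + f y"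
  shows "f (\<Sum>\<^sub># W) = (\<Sum>x\<in>set_mset W. real (count W x) *\<^sub>R f x)"
proof -
  have "f (\<Sum>\<^sub># W) = (\<Sum>x\<in>T. real (count W x) *\<^sub>R f x)" if "finite T" "set_mset W \<subseteq> T" for T
    using that(2)
  proof (induction W)
    case (add a W)
    have "(\<Sum>x\<in>T. real (count (add_mset a W) x) *\<^sub>R f x) =
        (\<Sum>x\<in>T. (if x = a then f x else 0) + real (count W x) *\<^sub>R f x)"
      by (intro sum.cong) (auto simp: scaleR_add_left)
    also have "\<dots> = f a + (\<Sum>x\<in>T. real (count W x) *\<^sub>R f x)"
      using add.prems that(1) by (simp add: sum.distrib)
    finally show ?case using add by (simp add: assms(2))
  qed (simp add: zero)
  from this[of "set_mset W"] show ?thesis by simp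
qed

text \<open>
The existence of one representation is also what gives the least length its defining property.
\<close>
lemma rep_length_le_card:
  assumes "finite S" "S \<subseteq> hilbert_basis C" "z = (\<Sum>x\<in>S. real (c x) *\<^sub>R x)"
  shows "rep_length C z \<le> card S"
    and "\<exists>l h. (\<forall>i\<in>{1..rep_length C z}. h i \<in> hilbert_basis C) \<and>
      z = (\<Sum>i=1..rep_length C z. real (l i :: nat) *\<^sub>R h i)"
proof -
  let ?P = "\<lambda>k. \<exists>(l :: nat \<Rightarrow> nat) h. (\<forall>i\<in>{1..k}. h i \<in> hilbert_basis C) \<and> z = (\<Sum>i=1..k. real (l i) *\<^sub>R h i)"
  obtain h where h: "bij_betw h {1..card S} S" using ex_bij_betw_nat_finite_1[OF assms(1)] by auto
  have "z = (\<Sum>i=1..card S. real (c (h i)) *\<^sub>R h i)"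
    unfolding assms(3) using sum.reindex_bij_betw[OF h, of "\<lambda>x. real (c x) *\<^sub>R x"] by simp
  moreover have "\<forall>i\<in>{1..card S}. h i \<in> hilbert_basis C" using h assms(2) by (auto simp: bij_betw_def)
  ultimately have P: "?P (card S)" by (intro exI[of _ "\<lambda>i. c (h i)"] exI[of _ h]) auto
  show "rep_length C z \<le> card S" unfolding rep_length_def by (rule Least_le[of ?P, OF P])
  show "?P (rep_length C z)" unfolding rep_length_def by (rule LeastI[of ?P, OF P])
qed

section \<open>The lower bound and the rank\<close>

text \<open>
A proper subspace has a nonzero normal vector \<open>a\<close>. The inner product of \<open>a\<close> with the point
\<open>\<Sum>\<^sub>j t^(e j) r j\<close>, where \<open>e\<close> numbers the coordinates, is a nonzero polynomial in \<open>t\<close>, because the \<open>r j\<close>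
span the space. So each of the finitely many spans excludes finitely many \<open>t\<close>.
\<close>
lemma moment_point_outside_spans:
  fixes r :: "'n::finite \<Rightarrow> real ^ 'n" and H :: "(real ^ 'n) set"
  assumes det: "det (columns_matrix r) \<noteq> 0" and H: "finite H"
  shows "\<exists>c :: 'n \<Rightarrow> nat. \<forall>X\<subseteq>H. card X < CARD('n) \<longrightarrow> (\<Sum>j\<in>UNIV. real (c j) *\<^sub>R r j) \<notin> span X"
proof -
  obtain e where e: "bij_betw e (UNIV :: 'n set) {0..<CARD('n)}"
    using ex_bij_betw_finite_nat[of "UNIV :: 'n set"] by auto
  define z where "z t = (\<Sum>j\<in>UNIV. real (t ^ e j) *\<^sub>R r j)" for t
  have fin: "finite {t. z t \<in> span X}" if X: "X \<subseteq> H" "card X < CARD('n)" for X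
  proof -
    have "dim X \<le> card X" using finite_subset[OF X(1) H] by (rule dim_le_card')
    then have "dim (span X) < DIM(real ^ 'n)" using X(2) by simp
    then obtain a where a: "a \<noteq> 0" "span X \<subseteq> {x. a \<bullet> x = 0}"
      using lowdim_subset_hyperplane[of "span X"] unfolding span_span by metis
    define c where "c k = a \<bullet> r (inv_into UNIV e k)" for k
    have eq: "a \<bullet> z t = (\<Sum>k\<le>CARD('n) - 1. c k * real t ^ k)" for t
    proof -
      have "a \<bullet> z t = (\<Sum>j\<in>UNIV. c (e j) * real t ^ e j)"
        using bij_betw_imp_inj_on[OF e] by (simp add: z_def c_def inner_sum_right mult.commute)
      also have "\<dots> = (\<Sum>k\<in>{0..<CARD('n)}. c k * real t ^ k)"
        using sum.reindex_bij_betw[OF e, of "\<lambda>k. c k * real t ^ k"] by simp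
      also have "{0..<CARD('n)} = {..CARD('n) - 1}"
        using zero_less_card_finite[where 'a = 'n] by (cases "CARD('n)") auto
      finally show ?thesis .
    qed
    have "\<exists>k\<le>CARD('n) - 1. c k \<noteq> 0"
    proof (rule ccontr)
      assume no: "\<not> ?thesis"
      have "a \<bullet> r j = 0" for j
      proof -
        have "e j < CARD('n)" using e by (auto simp: bij_betw_def)
        then have "c (e j) = 0" using no by auto
        then show ?thesis using bij_betw_imp_inj_on[OF e] by (simp add: c_def)
      qed
      moreover obtain x where "a = (\<Sum>j\<in>UNIV. x j *\<^sub>R r j)" using coordinates_exist[OF det] by metis
      ultimately have "a \<bullet> a = 0" by (metis (no_types, lifting) inner_sum_right inner_scaleR_right mult_zero_right sum.neutral)
      then show False using a by simp
    qed
    then have "finite {x :: real. (\<Sum>k\<le>CARD('n) - 1. c k * x ^ k) = 0}" by (simp add: polyfun_finite_roots)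
    then have "finite (real -` {x :: real. (\<Sum>k\<le>CARD('n) - 1. c k * x ^ k) = 0})"
      by (intro finite_vimageI) auto
    moreover have "{t. z t \<in> span X} \<subseteq> real -` {x. (\<Sum>k\<le>CARD('n) - 1. c k * x ^ k) = 0}"
      using a(2) eq by auto
    ultimately show ?thesis by (rule finite_subset[rotated])
  qed
  have "finite (\<Union>X\<in>{X. X \<subseteq> H \<and> card X < CARD('n)}. {t. z t \<in> span X})"
    using fin H by (intro finite_UN_I) auto
  then obtain t where "t \<notin> (\<Union>X\<in>{X. X \<subseteq> H \<and> card X < CARD('n)}. {t. z t \<in> span X})"
    using ex_new_if_finite infinite_UNIV_nat by blast
  then show ?thesis unfolding z_def by (intro exI[of _ "\<lambda>j. t ^ e j"]) auto
qed

theorem theorem1p1: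
  fixes r :: "'n::finite \<Rightarrow> real ^ 'n"
  assumes "\<And>j. r j \<in> int_vectors"
    and "1 \<le> \<bar>det (\<chi> i j. r j $ i)\<bar>"
    and "\<bar>det (\<chi> i j. r j $ i)\<bar> \<le> 5"
  shows "ICR (pos (range r)) = CARD('n)"
proof -
  let ?C = "pos (range r)"
  let ?M = "?C \<inter> int_vectors"
  note r = assms(1)
  have "\<bar>det (columns_matrix r)\<bar> \<in> \<int>" using det_columns_Ints[of r] r by (auto simp: abs_if)
  then obtain d where det: "\<bar>det (columns_matrix r)\<bar> = of_int d" by (auto elim: Ints_cases)
  have "1 \<le> real_of_int d" "real_of_int d \<le> 5" using assms(2,3) det by (auto simp: columns_matrix_def)
  then have d: "0 < d" "d \<le> 5" by linarith+
  have nz: "det (columns_matrix r) \<noteq> 0" using det d by auto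
  let ?f = "from_scaled r d"
  interpret small_lattice d "scaled_points r d"
    by (rule small_lattice_scaled_points[OF r det d])
  have M: "?M = ?f ` orthant"
    unfolding orthant_def by (rule integer_points_eq[OF r det d(1)])
  have inj: "inj ?f"
  proof (rule injI)
    fix u v assume "?f u = ?f v"
    then have "real_of_int (u $ j) / of_int d = of_int (v $ j) / of_int d" for j
      unfolding from_scaled_def by (rule coordinates_unique[OF nz])
    then show "u = v" using d by (simp add: vec_eq_iff)
  qed
  have f0: "?f 0 = 0" by (simp add: from_scaled_def)
  have f0_iff: "?f u = 0 \<longleftrightarrow> u = 0" for u using injD[OF inj, of u 0] f0 by auto
  have orth: "0 \<in> orthant" "u \<in> orthant \<Longrightarrow> v \<in> orthant \<Longrightarrow> u + v \<in> orthant" for u v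
    by (auto simp: orthant_def zero_in add_in)
  have zero: "0 \<in> ?M" unfolding M using orth(1) f0 by (metis imageI)
  have add: "x + y \<in> ?M" if "x \<in> ?M" "y \<in> ?M" for x y
    using that orth(2) unfolding M by (auto simp flip: from_scaled_add)
  have irr: "?f ` irreducibles orthant \<subseteq> irreducibles ?M"
    unfolding M irreducibles_def
    by (auto simp: f0_iff simp flip: from_scaled_add dest!: injD[OF inj])
  have short: "\<exists>S c. finite S \<and> S \<subseteq> irreducibles ?M \<and> card S \<le> CARD('n) \<and> z = (\<Sum>x\<in>S. real (c x) *\<^sub>R x)"
    if z: "z \<in> ?M" for z
  proof -
    obtain u where u: "u \<in> orthant" "z = ?f u" using z M by auto
    obtain W where W: "set_mset W \<subseteq> irreducibles orthant" "card (set_mset W) \<le> CARD('n)" "u = \<Sum>\<^sub># W"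
      using sum_of_few_irreducibles[OF u(1)] by auto
    have "z = (\<Sum>w\<in>set_mset W. real (count W w) *\<^sub>R ?f w)"
      unfolding u(2) W(3) by (rule hom_sum_mset) (simp_all add: f0 from_scaled_add)
    also have "\<dots> = (\<Sum>x\<in>?f ` set_mset W. real (count W (inv ?f x)) *\<^sub>R x)"
      using inj by (simp add: sum.reindex inj_on_subset)
    finally show ?thesis using W irr card_image_le[of "set_mset W" ?f]
      by (intro exI[of _ "?f ` set_mset W"] exI[of _ "\<lambda>x. count W (inv ?f x)"]) auto
  qed
  have "?M \<subseteq> nonneg_int_combinations (irreducibles ?M)"
    using short unfolding nonneg_int_combinations_def by blast
  then have HB: "hilbert_basis ?C = irreducibles ?M"
    by (intro hilbert_basis_eq_irreducibles zero add)
  have upper: "rep_length ?C z \<le> CARD('n)" if z: "z \<in> ?M" for z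
  proof -
    obtain S a where "finite S" "S \<subseteq> irreducibles ?M" "card S \<le> CARD('n)" "z = (\<Sum>x\<in>S. real (a x) *\<^sub>R x)"
      using short[OF z] by blast
    then show ?thesis using rep_length_le_card(1)[of S ?C z a] unfolding HB by linarith
  qed
  have fin: "finite (irreducibles ?M)"
  proof -
    \<comment> \<open>A vector with an entry greater than \<open>d\<close> splits off \<open>d e\<^sub>i\<close>.\<close>
    let ?B = "{u :: int ^ 'n. \<forall>i. u $ i \<in> {0..d}}"
    have "finite ?B"
    proof -
      have "?B \<subseteq> vec_lambda ` (PiE UNIV (\<lambda>_. {0..d}))"
        by (auto simp: image_iff intro!: bexI[of _ "vec_nth _"])
      then show ?thesis by (rule finite_subset) (auto intro!: finite_imageI finite_PiE)
    qed
    moreover have "irreducibles ?M \<subseteq> ?f ` ?B"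
    proof
      fix z assume z: "z \<in> irreducibles ?M"
      then obtain u where u: "u \<in> orthant" "z = ?f u" using M by (auto simp: irreducibles_def)
      have "u $ i \<le> d" for i
      proof (rule ccontr)
        assume "\<not> ?thesis"
        then have ui: "d < u $ i" by simp
        have "u - axis i d \<in> orthant" "axis i d \<in> orthant"
          using u ui d axis_in[of i] by (auto simp: orthant_def axis_def intro: diff_in)
        moreover have "z = ?f (axis i d) + ?f (u - axis i d)"
          by (simp add: u flip: from_scaled_add)
        ultimately have "?f (axis i d) = 0 \<or> ?f (u - axis i d) = 0"
          using z M unfolding irreducibles_def by blast
        then have "axis i d = 0 \<or> u = axis i d" by (simp add: f0_iff)
        then show False using ui d by (auto simp: axis_eq_0_iff)
      qed
      then show "z \<in> ?f ` ?B" using u by (auto simp: orthant_def)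
    qed
    ultimately show ?thesis by (metis finite_imageI finite_subset)
  qed
  obtain c where c: "\<And>X. X \<subseteq> irreducibles ?M \<Longrightarrow> card X < CARD('n) \<Longrightarrow> (\<Sum>j\<in>UNIV. real (c j) *\<^sub>R r j) \<notin> span X"
    using moment_point_outside_spans[OF nz fin] by blast
  define z where "z = (\<Sum>j\<in>UNIV. real (c j) *\<^sub>R r j)"
  have zM: "z \<in> ?M"
  proof
    show "z \<in> ?C" unfolding pos_range[OF inj_if_det_nonzero[OF nz]] z_def by auto
    show "z \<in> int_vectors" using r by (auto simp: z_def int_vectors_def sum_component intro!: Ints_sum)
  qed
  have "CARD('n) \<le> rep_length ?C z"
  proof (rule ccontr)
    assume less: "\<not> ?thesis"
    obtain S a where S: "finite S" "S \<subseteq> irreducibles ?M" "z = (\<Sum>x\<in>S. real (a x) *\<^sub>R x)"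
      using short[OF zM] by auto
    obtain l h where h: "\<forall>i\<in>{1..rep_length ?C z}. h i \<in> irreducibles ?M"
      and zh: "z = (\<Sum>i=1..rep_length ?C z. real (l i) *\<^sub>R h i)"
      using rep_length_le_card(2)[of S ?C z a] S unfolding HB by auto
    let ?X = "h ` {1..rep_length ?C z}"
    have "z \<in> span ?X" by (subst zh) (intro span_sum span_scale span_base imageI)
    moreover have "card ?X < CARD('n)"
      using less card_image_le[of "{1..rep_length ?C z}" h] by simp
    ultimately show False using c[of ?X] h by (auto simp: z_def)
  qed
  with upper[OF zM] have "rep_length ?C z = CARD('n)" by simp
  then have "CARD('n) \<in> rep_length ?C ` ?M" using zM by force
  moreover have "rep_length ?C ` ?M \<subseteq> {..CARD('n)}" using upper by auto
  ultimately show ?thesis unfolding ICR_def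
    by (intro Max_eqI) (auto intro: finite_subset)
qed

end
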